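(* Let $I=[0,a)$ and let $f:I\to\mathbb{R}$ be superterzatic, with associated constants $C(\bar x)$, $\bar x\in I$, as in the definition of superterzaticity. Let $k\ge 1$ and $n_1,\dots,n_k\ge 1$ be integers. For $i=1,\dots,k$ let $\mathbf{x}_i=(x_{i1},\dots,x_{in_i})\in I^{n_i}$, let $\mathbf{p}_i=(p_{i1},\dots,p_{in_i})$ with $p_{ij}>0$ for all $j$ and $\sum_{j=1}^{n_i}p_{ij}=1$, and let $\mathbf{r}_i=(r_{i1},\dots,r_{in_i})$ with $r_{ij}>0$ for all $j$ and $\sum_{j=1}^{n_i}r_{ij}=1$. Let $\mathbf{q}=(q_1,\dots,q_k)$ with $q_i>0$ for all $i$ and $\sum_{i=1}^k q_i=1$. Put $$m=\min_{1\le j_1\le n_1,\dots,1\le j_k\le n_k}\left\{\frac{p_{1j_1}\cdots p_{kj_k}}{r_{1j_1}\cdots r_{kj_k}}\right\},\qquad M=\max_{1\le j_1\le n_1,\dots,1\le j_k\le n_k}\left\{\frac{p_{1j_1}\cdots p_{kj_k}}{r_{1j_1}\cdots r_{kj_k}}\right\},$$ $$\bar x=\sum_{i=1}^k q_i\sum_{j=1}^{n_i}p_{ij}x_{ij},\qquad \check x=\sum_{i=1}^k q_i\sum_{j=1}^{n_i}r_{ij}x_{ij}.$$ Then $$J_k(f,\mathbf{p}_1,\dots,\mathbf{p}_k,\mathbf{q},\mathbf{x}_1,\dots,\mathbf{x}_k)-m\,J_k(f,\mathbf{r}_1,\dots,\mathbf{r}_k,\mathbf{q},\mathbf{x}_1,\dots,\mathbf{x}_k)$$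 $$\ge \sum_{j_1,\dots,j_k=1}^{n_1,\dots,n_k}\left(p_{1j_1}\cdots p_{kj_k}-m\,r_{1j_1}\cdots r_{kj_k}\right)\left(\sum_{i=1}^k q_ix_{ij_i}\right)\left[\left(\sum_{i=1}^k q_ix_{ij_i}-\bar x\right)C(\bar x)+\frac{f\left(\left|\sum_{i=1}^k q_ix_{ij_i}-\bar x\right|\right)}{\left|\sum_{i=1}^k q_ix_{ij_i}-\bar x\right|}\right]$$ $$+\,m\left(\sum_{i=1}^k q_i\sum_{j=1}^{n_i}r_{ij}x_{ij}\right)\left[\left(\sum_{i=1}^k q_i\sum_{j=1}^{n_i}(r_{ij}-p_{ij})x_{ij}\right)C(\bar x)+\frac{f\left(\left|\sum_{i=1}^k q_i\sum_{j=1}^{n_i}(r_{ij}-p_{ij})x_{ij}\right|\right)}{\left|\sum_{i=1}^k q_i\sum_{j=1}^{n_i}(r_{ij}-p_{ij})x_{ij}\right|}\right]$$ and $$M\,J_k(f,\mathbf{r}_1,\dots,\mathbf{r}_k,\mathbf{q},\mathbf{x}_1,\dots,\mathbf{x}_k)-J_k(f,\mathbf{p}_1,\dots,\mathbf{p}_k,\mathbf{q},\mathbf{x}_1,\dots,\mathbf{x}_k)$$ $$\ge \sum_{j_1,\dots,j_k=1}^{n_1,\dots,n_k}\left(M\,r_{1j_1}\cdots r_{kj_k}-p_{1j_1}\cdots p_{kj_k}\right)\left(\sum_{i=1}^k q_ix_{ij_i}\right)\left[\left(\sum_{i=1}^k q_ix_{ij_i}-\check x\right)C(\check x)+\frac{f\left(\left|\sum_{i=1}^k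 q_ix_{ij_i}-\check x\right|\right)}{\left|\sum_{i=1}^k q_ix_{ij_i}-\check x\right|}\right]$$ $$+\left(\sum_{i=1}^k q_i\sum_{j=1}^{n_i}p_{ij}x_{ij}\right)\left[\left(\sum_{i=1}^k q_i\sum_{j=1}^{n_i}(p_{ij}-r_{ij})x_{ij}\right)C(\check x)+\frac{f\left(\left|\sum_{i=1}^k q_i\sum_{j=1}^{n_i}(p_{ij}-r_{ij})x_{ij}\right|\right)}{\left|\sum_{i=1}^k q_i\sum_{j=1}^{n_i}(p_{ij}-r_{ij})x_{ij}\right|}\right].$$
   Context: Convention: the expression $f(0)/0$ is taken to be $0$ throughout. Superterzatic function: a function $f:I\to\mathbb{R}$ on an interval $I=[0,a)$ is superterzatic if for each $\bar x\in I$ there exists a real number $C(\bar x)$ such that $$\sum_{i=1}^n p_if(x_i)-f\left(\sum_{i=1}^n p_ix_i\right)\ \ge\ \sum_{i=1}^n p_ix_i\left[(x_i-\bar x)C(\bar x)+\frac{f(|x_i-\bar x|)}{|x_i-\bar x|}\right]$$ for all positive integers $n$, all $x_1,\dots,x_n\in I$ and all $p_1,\dots,p_n\ge 0$ with $\sum_{i=1}^n p_i=1$ and $\bar x=\sum_{i=1}^n p_ix_i$. The number $C(\bar x)$ depends only on $f$ and $\bar x$. Generalized Jensen functional: for $f:I\to\mathbb{R}$, positive weights $\mathbf{p}_i=(p_{i1},\dots,p_{in_i})$ with $\sum_{j=1}^{n_i}p_{ij}=1$, points $\mathbf{x}_i=(x_{i1},\dots,x_{in_i})\in I^{n_i}$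 ($i=1,\dots,k$), and positive weights $\mathbf{q}=(q_1,\dots,q_k)$ with $\sum_{i=1}^kq_i=1$, $$J_k(f,\mathbf{p}_1,\dots,\mathbf{p}_k,\mathbf{q},\mathbf{x}_1,\dots,\mathbf{x}_k)=\sum_{j_1,\dots,j_k=1}^{n_1,\dots,n_k}p_{1j_1}\cdots p_{kj_k}\,f\left(\sum_{i=1}^kq_ix_{ij_i}\right)-f\left(\sum_{i=1}^kq_i\sum_{j=1}^{n_i}p_{ij}x_{ij}\right).$$ The notation $\sum_{j_1,\dots,j_k=1}^{n_1,\dots,n_k}$ means the sum over all tuples $(j_1,\dots,j_k)$ with $1\le j_i\le n_i$ for each $i$. *)

theory Defs
  imports Complex_Main "HOL-Library.FuncSet"
begin

text \<open>A function on the interval \<open>[0, a)\<close> is represented by a total function of type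
  \<open>real \<Rightarrow> real\<close>; only its values on \<open>{0..<a}\<close> matter, since \<open>\<bar>s - t\<bar> \<in> {0..<a}\<close> whenever
  \<open>s, t \<in> {0..<a}\<close>. The convention that \<open>f(0)/0\<close> is \<open>0\<close> is built in, as \<open>y / 0 = 0\<close> in HOL.\<close>

definition superterzatic_const :: "real \<Rightarrow> (real \<Rightarrow> real) \<Rightarrow> real \<Rightarrow> real \<Rightarrow> bool" where
  "superterzatic_const a f xb c \<longleftrightarrow>
    (\<forall>(n::nat) (x::nat \<Rightarrow> real) (p::nat \<Rightarrow> real).
      n \<ge> 1 \<and> (\<forall>i\<in>{1..n}. x i \<in> {0..<a}) \<and> (\<forall>i\<in>{1..n}. p i \<ge> 0) \<and>
      (\<Sum>i=1..n. p i) = 1 \<and> xb = (\<Sum>i=1..n. p i * x i)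
      \<longrightarrow> (\<Sum>i=1..n. p i * f (x i)) - f (\<Sum>i=1..n. p i * x i)
          \<ge> (\<Sum>i=1..n. p i * x i * ((x i - xb) * c + f \<bar>x i - xb\<bar> / \<bar>x i - xb\<bar>)))"

definition superterzatic :: "real \<Rightarrow> (real \<Rightarrow> real) \<Rightarrow> bool" where
  "superterzatic a f \<longleftrightarrow> (\<forall>xb\<in>{0..<a}. \<exists>c. superterzatic_const a f xb c)"

text \<open>Index tuples \<open>(j\<^sub>1, \<dots>, j\<^sub>k)\<close> with \<open>1 \<le> j\<^sub>i \<le> n\<^sub>i\<close>; extensionality makes
  each tuple occur exactly once.\<close>

definition index_tuples :: "nat \<Rightarrow> (nat \<Rightarrow> nat) \<Rightarrow> (nat \<Rightarrow> nat) set" where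
  "index_tuples k n = (\<Pi>\<^sub>E i\<in>{1..k}. {1..n i})"

definition jensen_functional ::
  "nat \<Rightarrow> (nat \<Rightarrow> nat) \<Rightarrow> (real \<Rightarrow> real) \<Rightarrow> (nat \<Rightarrow> nat \<Rightarrow> real) \<Rightarrow> (nat \<Rightarrow> real)
    \<Rightarrow> (nat \<Rightarrow> nat \<Rightarrow> real) \<Rightarrow> real" where
  "jensen_functional k n f p q x =
    (\<Sum>j\<in>index_tuples k n. (\<Prod>i=1..k. p i (j i)) * f (\<Sum>i=1..k. q i * x i (j i)))
    - f (\<Sum>i=1..k. q i * (\<Sum>j=1..n i. p i j * x i j))"

end

theory Submission
  imports Defs "HOL-Analysis.Convex"
begin

text \<open>
  Enumerate the index tuples and put \<open>X\<^sub>j = \<Sum>\<^sub>i q\<^sub>i x\<^bsub>i j\<^sub>i\<^esub>\<close>, with product weights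
  \<open>P\<^sub>j = \<Prod>\<^sub>i p\<^bsub>i j\<^sub>i\<^esub>\<close> and \<open>R\<^sub>j = \<Prod>\<^sub>i r\<^bsub>i j\<^sub>i\<^esub>\<close>.  Each family of product weights is again a
  probability vector (\<open>sum_product_weights\<close>).  Its marginals are the given weights, so by
  linearity the barycentre of the \<open>X\<^sub>j\<close> is the \<open>q\<close>-weighted mean of the barycentres of the factors
  (\<open>barycentre_product_weights\<close>).  Hence the generalized Jensen functional is an ordinary Jensen
  functional over one finite index set.

  Over a single index set, let \<open>U\<close> and \<open>V\<close> be probability vectors with barycentres \<open>u\<close> and \<open>v\<close>, and
  let \<open>c V\<^sub>j \<le> b U\<^sub>j\<close> for all \<open>j\<close>.  Collapsing the dominated mass \<open>c V\<close> to its barycentre turns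
  \<open>b U\<close> into the measure with mass \<open>b U\<^sub>j - c V\<^sub>j\<close> at \<open>X\<^sub>j\<close> and mass \<open>c\<close> at \<open>v\<close>.  It is nonnegative,
  and it still has total mass \<open>b\<close> and barycentre \<open>u\<close>.  The defining inequality of
  superterzaticity at \<open>u\<close>, scaled by \<open>b\<close>, is then the comparison
  \<open>jensen_comparison\<close> of the two Jensen functionals.

  By the choice of \<open>m\<close> and \<open>M\<close>, both \<open>m R \<le> P\<close> and \<open>P \<le> M R\<close> hold.  The first of these
  gives the lower bound (\<open>b = 1\<close>, \<open>c = m\<close>), and the second, with the roles of \<open>P\<close> and \<open>R\<close>
  exchanged, the upper bound (\<open>b = M\<close>, \<open>c = 1\<close>).
\<close>

text \<open>The surplus over Jensen's inequality that superterzaticity guarantees for each unit of mass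
  placed at \<open>s\<close>, within a probability measure of barycentre \<open>t\<close>.\<close>

definition superterzatic_gap :: "(real \<Rightarrow> real) \<Rightarrow> real \<Rightarrow> real \<Rightarrow> real \<Rightarrow> real" where
  "superterzatic_gap f c t s = s * ((s - t) * c + f \<bar>s - t\<bar> / \<bar>s - t\<bar>)"

lemma barycentre_in_interval:
  fixes X w :: "'i \<Rightarrow> real"
  assumes "finite A" "\<And>i. i \<in> A \<Longrightarrow> X i \<in> {0..<a}" "\<And>i. i \<in> A \<Longrightarrow> w i \<ge> 0" "sum w A = 1"
  shows "(\<Sum>i\<in>A. w i * X i) \<in> {0..<a}"
  using convex_sum[of A "{0..<a}" w X] assms by (simp add: convex_real_interval)

lemma superterzatic_const_finite_sum:
  fixes X w :: "'i \<Rightarrow> real"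
  assumes C: "superterzatic_const a f t c"
    and A: "finite A" "\<And>i. i \<in> A \<Longrightarrow> X i \<in> {0..<a}"
    and w: "\<And>i. i \<in> A \<Longrightarrow> w i \<ge> 0" "sum w A = 1"
    and t: "t = (\<Sum>i\<in>A. w i * X i)"
  shows "(\<Sum>i\<in>A. w i * f (X i)) - f t \<ge> (\<Sum>i\<in>A. w i * superterzatic_gap f c t (X i))"
proof -
  obtain h where h: "bij_betw h {1..card A} A"
    using ex_bij_betw_nat_finite_1[OF A(1)] by blast
  have enum: "(\<Sum>i=1..card A. g (h i)) = sum g A" for g :: "'i \<Rightarrow> real"
    by (rule sum.reindex_bij_betw[OF h])
  have hA: "h i \<in> A" if "i \<in> {1..card A}" for i
    using h that by (auto simp: bij_betw_def)
  have "A \<noteq> {}" using w(2) by auto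
  then have "card A \<ge> 1" using A(1) by (simp add: Suc_le_eq card_gt_0_iff)
  moreover have "t = (\<Sum>i=1..card A. w (h i) * X (h i))"
    unfolding t by (rule enum[symmetric])
  moreover have "(\<Sum>i=1..card A. w (h i)) = 1" using enum w(2) by simp
  ultimately have
    "(\<Sum>i=1..card A. w (h i) * f (X (h i))) - f (\<Sum>i=1..card A. w (h i) * X (h i))
      \<ge> (\<Sum>i=1..card A. w (h i) * X (h i)
          * ((X (h i) - t) * c + f \<bar>X (h i) - t\<bar> / \<bar>X (h i) - t\<bar>))"
    using C[unfolded superterzatic_const_def, rule_format,
        of "card A" "\<lambda>i. X (h i)" "\<lambda>i. w (h i)"] A(2) w(1) hA
    by blast
  then show ?thesis
    unfolding enum[of "\<lambda>i. w i * f (X i)"] enum[of "\<lambda>i. w i * X i"]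
      enum[of "\<lambda>i. w i * X i * ((X i - t) * c + f \<bar>X i - t\<bar> / \<bar>X i - t\<bar>)"] t[symmetric]
    by (simp add: superterzatic_gap_def mult.assoc)
qed

text \<open>Replacing the part \<open>c V\<close> of the measure \<open>b U\<close> by a single mass \<open>c\<close> at its
  barycentre \<open>v\<close> keeps the total mass and the barycentre, so the superterzatic inequality at
  \<open>u\<close> applies to the resulting measure after division by \<open>b\<close>.\<close>

lemma jensen_comparison:
  fixes X U V :: "'i \<Rightarrow> real"
  assumes C: "superterzatic_const a f u d"
    and A: "finite A" "\<And>i. i \<in> A \<Longrightarrow> X i \<in> {0..<a}"
    and b: "b > 0" and c: "c \<ge> 0"
    and dom: "\<And>i. i \<in> A \<Longrightarrow> c * V i \<le> b * U i"
    and V: "\<And>i. i \<in> A \<Longrightarrow> V i \<ge> 0"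
    and mass: "sum U A = 1" "sum V A = 1"
    and u: "u = (\<Sum>i\<in>A. U i * X i)" and v: "v = (\<Sum>i\<in>A. V i * X i)"
  shows "b * ((\<Sum>i\<in>A. U i * f (X i)) - f u) - c * ((\<Sum>i\<in>A. V i * f (X i)) - f v)
    \<ge> (\<Sum>i\<in>A. (b * U i - c * V i) * superterzatic_gap f d u (X i))
      + c * superterzatic_gap f d u v"
proof -
  \<comment> \<open>The collapsed mass sits at the new index \<open>None\<close>: \<open>v\<close> may coincide with some \<open>X i\<close>, so the
    measure has to be indexed rather than supported on points.  Division by \<open>b\<close> normalizes it.\<close>
  define B where "B = insert None (Some ` A)"
  define Y where "Y = case_option v X"
  define w where "w = case_option (c / b) (\<lambda>i. (b * U i - c * V i) / b)"
  have sumB: "(\<Sum>s\<in>B. w s * g (Y s))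
      = ((\<Sum>i\<in>A. (b * U i - c * V i) * g (X i)) + c * g v) / b" for g :: "real \<Rightarrow> real"
    using A(1) by (simp add: B_def Y_def w_def sum.reindex add_divide_distrib sum_divide_distrib)
  have diff: "(\<Sum>i\<in>A. (b * U i - c * V i) * g i)
      = b * (\<Sum>i\<in>A. U i * g i) - c * (\<Sum>i\<in>A. V i * g i)" for g
    by (simp add: left_diff_distrib sum_subtractf sum_distrib_left mult.assoc)
  have "v \<in> {0..<a}"
    unfolding v by (rule barycentre_in_interval) (use A V mass in auto)
  then have Y: "Y s \<in> {0..<a}" if "s \<in> B" for s
    using that A(2) by (auto simp: B_def Y_def)
  have w0: "w s \<ge> 0" if "s \<in> B" for s
    using that b c dom by (auto simp: B_def w_def)
  have w1: "sum w B = 1"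
    using sumB[of "\<lambda>_. 1"] diff[of "\<lambda>_. 1"] mass b by simp
  have uB: "u = (\<Sum>s\<in>B. w s * Y s)"
    using sumB[of "\<lambda>s. s"] diff[of X] u v b by simp
  have scale: "z' / b \<le> z / b - y \<longleftrightarrow> z' \<le> z - b * y" for y z z' :: real
    using b by (simp add: field_simps)
  have "(\<Sum>s\<in>B. w s * f (Y s)) - f u \<ge> (\<Sum>s\<in>B. w s * superterzatic_gap f d u (Y s))"
    by (rule superterzatic_const_finite_sum[OF C _ Y w0 w1 uB]) (use A(1) in \<open>auto simp: B_def\<close>)
  then have "(\<Sum>i\<in>A. (b * U i - c * V i) * f (X i)) + c * f v - b * f u
      \<ge> (\<Sum>i\<in>A. (b * U i - c * V i) * superterzatic_gap f d u (X i))
        + c * superterzatic_gap f d u v"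
    unfolding sumB scale .
  then show ?thesis
    unfolding diff[of "\<lambda>i. f (X i)"] by (simp add: algebra_simps)
qed

lemma finite_index_tuples: "finite (index_tuples k n)"
  by (simp add: index_tuples_def finite_PiE)

lemma index_tuplesD: "j \<in> index_tuples k n \<Longrightarrow> i \<in> {1..k} \<Longrightarrow> j i \<in> {1..n i}"
  by (auto simp: index_tuples_def PiE_iff)

lemma index_tuples_nonempty: "\<forall>i\<in>{1..k}. n i \<ge> 1 \<Longrightarrow> index_tuples k n \<noteq> {}"
  by (auto simp: index_tuples_def PiE_eq_empty_iff)

lemma sum_prod_index_tuples:
  fixes g :: "nat \<Rightarrow> nat \<Rightarrow> real"
  shows "(\<Sum>j\<in>index_tuples k n. \<Prod>i=1..k. g i (j i)) = (\<Prod>i=1..k. \<Sum>j=1..n i. g i j)"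
  unfolding index_tuples_def by (rule prod_sum_PiE[symmetric]) auto

lemma sum_product_weights:
  fixes p :: "nat \<Rightarrow> nat \<Rightarrow> real"
  assumes "\<forall>i\<in>{1..k}. (\<Sum>j=1..n i. p i j) = 1"
  shows "(\<Sum>j\<in>index_tuples k n. \<Prod>i=1..k. p i (j i)) = 1"
  unfolding sum_prod_index_tuples using assms by simp

text \<open>The \<open>l\<close>-th marginal of the product of probability weights is the \<open>l\<close>-th factor: write
  \<open>y (j l)\<close> as a product over all \<open>i\<close> whose factors are \<open>1\<close> for \<open>i \<noteq> l\<close>, so that the sum over
  tuples factorizes.\<close>

lemma marginal_product_weights:
  fixes p :: "nat \<Rightarrow> nat \<Rightarrow> real" and y :: "nat \<Rightarrow> real"
  assumes p: "\<forall>i\<in>{1..k}. (\<Sum>j=1..n i. p i j) = 1" and l: "l \<in> {1..k}"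
  shows "(\<Sum>j\<in>index_tuples k n. (\<Prod>i=1..k. p i (j i)) * y (j l)) = (\<Sum>j=1..n l. p l j * y j)"
proof -
  define g where "g i s = p i s * (if i = l then y s else 1)" for i s
  have "(\<Prod>i=1..k. p i (j i)) * y (j l) = (\<Prod>i=1..k. g i (j i))" for j
    using l by (simp add: g_def prod.distrib prod.delta)
  then have "(\<Sum>j\<in>index_tuples k n. (\<Prod>i=1..k. p i (j i)) * y (j l))
      = (\<Prod>i=1..k. \<Sum>j=1..n i. g i j)"
    by (simp only: sum_prod_index_tuples)
  also have "\<dots> = (\<Prod>i=1..k. if i = l then \<Sum>j=1..n l. p l j * y j else 1)"
    using p by (intro prod.cong) (auto simp: g_def)
  finally show ?thesis using l by (simp add: prod.delta)
qed

lemma barycentre_product_weights: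
  fixes p x :: "nat \<Rightarrow> nat \<Rightarrow> real" and q :: "nat \<Rightarrow> real"
  assumes p: "\<forall>i\<in>{1..k}. (\<Sum>j=1..n i. p i j) = 1"
  shows "(\<Sum>j\<in>index_tuples k n. (\<Prod>i=1..k. p i (j i)) * (\<Sum>i=1..k. q i * x i (j i)))
    = (\<Sum>i=1..k. q i * (\<Sum>j=1..n i. p i j * x i j))"
proof -
  have "(\<Sum>j\<in>index_tuples k n. (\<Prod>i=1..k. p i (j i)) * (\<Sum>l=1..k. q l * x l (j l)))
      = (\<Sum>l=1..k. \<Sum>j\<in>index_tuples k n. (\<Prod>i=1..k. p i (j i)) * (q l * x l (j l)))"
    unfolding sum_distrib_left by (rule sum.swap)
  also have "\<dots> = (\<Sum>l=1..k. \<Sum>j=1..n l. p l j * (q l * x l j))"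
    by (intro sum.cong refl marginal_product_weights[OF p, where y = "\<lambda>s. q l * x l s" for l]) auto
  finally show ?thesis by (simp add: sum_distrib_left ac_simps)
qed

theorem theorem6:
  fixes a :: real and f C :: "real \<Rightarrow> real"
    and k :: nat and n :: "nat \<Rightarrow> nat"
    and x p r :: "nat \<Rightarrow> nat \<Rightarrow> real" and q :: "nat \<Rightarrow> real"
    and m M xbar xcheck :: real
  assumes "a > 0"
    and "superterzatic a f"
    and "\<forall>t\<in>{0..<a}. superterzatic_const a f t (C t)"
    and "k \<ge> 1"
    and "\<forall>i\<in>{1..k}. n i \<ge> 1"
    and "\<forall>i\<in>{1..k}. \<forall>j\<in>{1..n i}. x i j \<in> {0..<a}"
    and "\<forall>i\<in>{1..k}. \<forall>j\<in>{1..n i}. p i j > 0"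
    and "\<forall>i\<in>{1..k}. (\<Sum>j=1..n i. p i j) = 1"
    and "\<forall>i\<in>{1..k}. \<forall>j\<in>{1..n i}. r i j > 0"
    and "\<forall>i\<in>{1..k}. (\<Sum>j=1..n i. r i j) = 1"
    and "\<forall>i\<in>{1..k}. q i > 0"
    and "(\<Sum>i=1..k. q i) = 1"
    and "m = Min ((\<lambda>j. (\<Prod>i=1..k. p i (j i)) / (\<Prod>i=1..k. r i (j i))) ` index_tuples k n)"
    and "M = Max ((\<lambda>j. (\<Prod>i=1..k. p i (j i)) / (\<Prod>i=1..k. r i (j i))) ` index_tuples k n)"
    and "xbar = (\<Sum>i=1..k. q i * (\<Sum>j=1..n i. p i j * x i j))"
    and "xcheck = (\<Sum>i=1..k. q i * (\<Sum>j=1..n i. r i j * x i j))"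
  shows
    "jensen_functional k n f p q x - m * jensen_functional k n f r q x
       \<ge> (\<Sum>j\<in>index_tuples k n.
            ((\<Prod>i=1..k. p i (j i)) - m * (\<Prod>i=1..k. r i (j i)))
            * (\<Sum>i=1..k. q i * x i (j i))
            * (((\<Sum>i=1..k. q i * x i (j i)) - xbar) * C xbar
               + f \<bar>(\<Sum>i=1..k. q i * x i (j i)) - xbar\<bar>
                 / \<bar>(\<Sum>i=1..k. q i * x i (j i)) - xbar\<bar>))
         + m * (\<Sum>i=1..k. q i * (\<Sum>j=1..n i. r i j * x i j))
           * ((\<Sum>i=1..k. q i * (\<Sum>j=1..n i. (r i j - p i j) * x i j)) * C xbar
              + f \<bar>\<Sum>i=1..k. q i * (\<Sum>j=1..n i. (r i j - p i j) * x i j)\<bar>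
                / \<bar>\<Sum>i=1..k. q i * (\<Sum>j=1..n i. (r i j - p i j) * x i j)\<bar>)
     \<and> M * jensen_functional k n f r q x - jensen_functional k n f p q x
       \<ge> (\<Sum>j\<in>index_tuples k n.
            (M * (\<Prod>i=1..k. r i (j i)) - (\<Prod>i=1..k. p i (j i)))
            * (\<Sum>i=1..k. q i * x i (j i))
            * (((\<Sum>i=1..k. q i * x i (j i)) - xcheck) * C xcheck
               + f \<bar>(\<Sum>i=1..k. q i * x i (j i)) - xcheck\<bar>
                 / \<bar>(\<Sum>i=1..k. q i * x i (j i)) - xcheck\<bar>))
         + (\<Sum>i=1..k. q i * (\<Sum>j=1..n i. p i j * x i j))
           * ((\<Sum>i=1..k. q i * (\<Sum>j=1..n i. (p i j - r i j) * x i j)) * C xcheck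
              + f \<bar>\<Sum>i=1..k. q i * (\<Sum>j=1..n i. (p i j - r i j) * x i j)\<bar>
                / \<bar>\<Sum>i=1..k. q i * (\<Sum>j=1..n i. (p i j - r i j) * x i j)\<bar>)"
proof -
  define A where "A = index_tuples k n"
  define X where "X = (\<lambda>j. \<Sum>i=1..k. q i * x i (j i))"
  define P where "P = (\<lambda>j. \<Prod>i=1..k. p i (j i))"
  define R where "R = (\<lambda>j. \<Prod>i=1..k. r i (j i))"
  have A: "finite A" "A \<noteq> {}"
    using finite_index_tuples index_tuples_nonempty assms(5) by (auto simp: A_def)
  have P: "P j > 0" and R: "R j > 0" and X: "X j \<in> {0..<a}" if "j \<in> A" for j
  proof -
    have j: "j i \<in> {1..n i}" if "i \<in> {1..k}" for i
      using index_tuplesD that \<open>j \<in> A\<close> unfolding A_def by blast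
    show "P j > 0" "R j > 0"
      unfolding P_def R_def using assms(7,9) j by (auto intro!: prod_pos)
    show "X j \<in> {0..<a}"
      unfolding X_def
      by (rule barycentre_in_interval) (use assms(6,11,12) j in \<open>auto simp: less_imp_le\<close>)
  qed
  have P1: "sum P A = 1" and R1: "sum R A = 1"
    using sum_product_weights assms(8,10) by (auto simp: A_def P_def R_def)
  have xbar: "xbar = (\<Sum>j\<in>A. P j * X j)" and xcheck: "xcheck = (\<Sum>j\<in>A. R j * X j)"
    unfolding A_def P_def R_def X_def assms(15,16)
    by (simp_all only: barycentre_product_weights[OF assms(8)]
        barycentre_product_weights[OF assms(10)])
  have "xbar \<in> {0..<a}" "xcheck \<in> {0..<a}"
    unfolding xbar xcheck
    by (rule barycentre_in_interval; use A X P R P1 R1 in \<open>simp add: less_imp_le\<close>)+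
  then have C: "superterzatic_const a f xbar (C xbar)" "superterzatic_const a f xcheck (C xcheck)"
    using assms(3) by auto

  have m: "m = Min ((\<lambda>j. P j / R j) ` A)" and M: "M = Max ((\<lambda>j. P j / R j) ` A)"
    using assms(13,14) by (auto simp: A_def P_def R_def)
  have "m \<in> (\<lambda>j. P j / R j) ` A" "M \<in> (\<lambda>j. P j / R j) ` A"
    unfolding m M using A by (auto intro!: Min_in Max_in)
  then have pos: "m > 0" "M > 0"
    using P R by auto
  have lower: "m * R j \<le> 1 * P j" and upper: "1 * P j \<le> M * R j" if "j \<in> A" for j
  proof -
    have "m \<le> P j / R j" "P j / R j \<le> M"
      unfolding m M using A that by auto
    then show "m * R j \<le> 1 * P j" "1 * P j \<le> M * R j"
      using R[OF that] by (simp_all add: field_simps)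
  qed

  have J: "jensen_functional k n f p q x = (\<Sum>j\<in>A. P j * f (X j)) - f xbar"
    "jensen_functional k n f r q x = (\<Sum>j\<in>A. R j * f (X j)) - f xcheck"
    by (simp_all add: jensen_functional_def A_def P_def R_def X_def assms(15,16))
  have gaps: "(\<Sum>i=1..k. q i * (\<Sum>j=1..n i. (r i j - p i j) * x i j)) = xcheck - xbar"
    "(\<Sum>i=1..k. q i * (\<Sum>j=1..n i. (p i j - r i j) * x i j)) = xbar - xcheck"
    unfolding assms(15,16)
    by (simp_all add: left_diff_distrib right_diff_distrib sum_subtractf)

  have "1 * ((\<Sum>j\<in>A. P j * f (X j)) - f xbar) - m * ((\<Sum>j\<in>A. R j * f (X j)) - f xcheck)
      \<ge> (\<Sum>j\<in>A. (1 * P j - m * R j) * superterzatic_gap f (C xbar) xbar (X j))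
        + m * superterzatic_gap f (C xbar) xbar xcheck"
    by (rule jensen_comparison[OF C(1) A(1) X _ _ lower _ P1 R1 xbar xcheck])
      (use pos R in \<open>auto simp: less_imp_le\<close>)
  moreover
  have "M * ((\<Sum>j\<in>A. R j * f (X j)) - f xcheck) - 1 * ((\<Sum>j\<in>A. P j * f (X j)) - f xbar)
      \<ge> (\<Sum>j\<in>A. (M * R j - 1 * P j) * superterzatic_gap f (C xcheck) xcheck (X j))
        + 1 * superterzatic_gap f (C xcheck) xcheck xbar"
    by (rule jensen_comparison[OF C(2) A(1) X _ _ upper _ R1 P1 xcheck xbar])
      (use pos P in \<open>auto simp: less_imp_le\<close>)
  ultimately show ?thesis
    unfolding J gaps assms(15)[symmetric] assms(16)[symmetric]
    unfolding A_def[symmetric] P_def[THEN fun_cong, symmetric] R_def[THEN fun_cong, symmetric]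
      X_def[THEN fun_cong, symmetric]
    by (simp add: superterzatic_gap_def mult.assoc)
qed

end
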